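(* Let $t\ge1$ be an integer and let $\beta^*_t$ be as defined in the context. For integers $M$ and residues $c$, write $\sum_{n\equiv c \,(3),\, n>0}^{M}$ for the sum over integers $n$ with $0<n\le M$ and $n\equiv c \pmod 3$ (empty if $M\le 0$). For an integer $n>0$ put $$u(n) := \frac{1}{2} + \mathbb{1}_{2 \mid n} \frac{(-1)^{n/2}}{2^n} - \frac{3}{2} \mathbb{1}_{3 \mid n} \frac{1}{2^{2n/3}},$$ $$v(n) := \frac{1}{2} + \frac{1}{4} \mathbb{1}_{2 \mid n} \frac{(-1)^{n/2}}{2^n} + \frac{1}{4} \mathbb{1}_{2 \mid (n-1)} \frac{(-1)^{(n-1)/2}}{2^n} - \frac{3}{4} \mathbb{1}_{3 \mid n} \frac{1}{2^{2n/3}}.$$ If $t$ is even, then \begin{align*} \beta^*_t = \frac12\Bigg( &\sum_{\substack{n \equiv \frac{t}{2} - 2 \,(3)\\ n>0}}^{\frac t2-2} \frac{1}{n} - \sum_{\substack{n \equiv \frac{t}{2} - 2 \,(3)\\ n>0}}^{\frac t2-2} \frac{u(n)}{n} + \mathbb{1}_{6 \mid (t-4)} \int_{1/2}^1 \frac{(1-x)^{\frac{t+2}{3}-1}}{x}\, dx - \sum_{\substack{n \equiv \frac{t}{2} - 2 \,(3)\\ n>0}}^{\frac t2-2} \frac{v(n)}{n+3/2} \\ &+ \sum_{\substack{n \equiv \frac{t}{2} - 1 \,(3)\\ n>0}}^{\frac t2-1} \frac{1}{n} - \sum_{\substack{n \equiv \frac{t}{2} - 1 \,(3)\\ n>0}}^{\frac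 t2-1} \frac{u(n)}{n} + \mathbb{1}_{6 \mid (t-2)} \int_{1/2}^1 \frac{(1-x)^{\frac{t+1}{3}-1}}{x}\, dx - \sum_{\substack{n \equiv \frac{t}{2} - 1 \,(3)\\ n>0}}^{\frac t2-4} \frac{v(n)}{n+3/2}\Bigg). \end{align*} If $t$ is odd, then \begin{align*} \beta^*_t = \frac12\Bigg( &\sum_{\substack{n \equiv \frac{t-1}{2} \,(3)\\ n>0}}^{\frac{t-1}{2}} \frac{1}{n} - \sum_{\substack{n \equiv \frac{t-1}{2} \,(3)\\ n>0}}^{\frac{t-1}{2}} \frac{u(n)}{n} + \mathbb{1}_{6 \mid (t-1)} \int_{1/2}^1 \frac{(1-x)^{\frac{t+2}{3}-1}}{x}\, dx - \sum_{\substack{n \equiv \frac{t-1}{2} \,(3)\\ n>0}}^{\frac{t-1}{2}-3} \frac{v(n)}{n+3/2} \\ &+ \sum_{\substack{n \equiv \frac{t-5}{2} \,(3)\\ n>0}}^{\frac{t-5}{2}} \frac{1}{n} - \sum_{\substack{n \equiv \frac{t-5}{2} \,(3)\\ n>0}}^{\frac{t-5}{2}} \frac{u(n)}{n} + \mathbb{1}_{6 \mid (t-5)} \int_{1/2}^1 \frac{(1-x)^{\frac{t+1}{3}-1}}{x}\, dx - \sum_{\substack{n \equiv \frac{t-5}{2} \,(3)\\ n>0}}^{\frac{t-5}{2}} \frac{v(n)}{n+3/2}\Bigg). \end{align*}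
   Context: $\mathbb{1}_{P}$ is $1$ if the condition $P$ holds and $0$ otherwise. For positive $a,c$ put $I(a,c) := \int_0^\infty \frac{e^{-ax}}{(1+e^{-2x})^c}\,dx$. For $t$ even, $$\beta_t^* := \sum_{k = 0}^{\lfloor (t-4)/6 \rfloor} \binom{\frac{t-2k-2}{2}}{2k+1} I\!\left(4k+4, \tfrac{t-2k}{2}\right) + \sum_{k=0}^{\lfloor (t-2)/6 \rfloor} \binom{\frac{t-2k-2}{2}}{2k} I\!\left(4k+2, \tfrac{t-2k}{2}\right),$$ and for $t$ odd, $$\beta_t^* := \sum_{k = 0}^{\lfloor (t-1)/6 \rfloor} \binom{\frac{t-2k-1}{2}}{2k} I\!\left(4k+2, \tfrac{t-2k+1}{2}\right) + \sum_{k=0}^{\lfloor (t-5)/6 \rfloor} \binom{\frac{t-2k-3}{2}}{2k+1} I\!\left(4k+4, \tfrac{t-2k-1}{2}\right),$$ with ordinary binomial coefficients and empty sums equal to $0$. (This $\beta^*_t$ is the constant with $\sum_{\lambda\in\mathcal{DO}(n)} n_t(\lambda) \sim \beta^*_t \frac{\sqrt[4]{3}}{\pi\sqrt[4]{2}\,n^{1/4}}e^{\pi\sqrt{n/6}}$, where $n_t(\lambda)$ counts hooks of length $t$ in partitions into distinct odd parts.) *)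

theory Defs
  imports "HOL-Analysis.Analysis" "HOL-Number_Theory.Cong"
begin

definition I_integral :: "real \<Rightarrow> real \<Rightarrow> real" where
  "I_integral a c = integral {0..} (\<lambda>x. exp (- a * x) / (1 + exp (- 2 * x)) powr c)"

text \<open>The argument \<open>t\<close> is an integer so that \<open>div\<close> is the mathematical floor (negative upper limits
  give empty sums) and subtraction does not truncate. The division by 2 in the binomial
  coefficients is exact, and for \<open>k\<close> in the range of summation its result is nonnegative.\<close>

definition beta_star :: "int \<Rightarrow> real" where
  "beta_star t =
    (if even t then
       (\<Sum>k::nat | int k \<le> (t - 4) div 6.
          real (nat ((t - 2 * int k - 2) div 2) choose (2 * k + 1)) *
          I_integral (4 * real k + 4) ((real_of_int t - 2 * real k) / 2))
     + (\<Sum>k::nat | int k \<le> (t - 2) div 6.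
          real (nat ((t - 2 * int k - 2) div 2) choose (2 * k)) *
          I_integral (4 * real k + 2) ((real_of_int t - 2 * real k) / 2))
     else
       (\<Sum>k::nat | int k \<le> (t - 1) div 6.
          real (nat ((t - 2 * int k - 1) div 2) choose (2 * k)) *
          I_integral (4 * real k + 2) ((real_of_int t - 2 * real k + 1) / 2))
     + (\<Sum>k::nat | int k \<le> (t - 5) div 6.
          real (nat ((t - 2 * int k - 3) div 2) choose (2 * k + 1)) *
          I_integral (4 * real k + 4) ((real_of_int t - 2 * real k - 1) / 2)))"

text \<open>The residue \<open>c\<close> and the upper limit \<open>M\<close> may be negative, whence the type \<open>int\<close>.\<close>

definition sum_mod3 :: "int \<Rightarrow> int \<Rightarrow> (nat \<Rightarrow> real) \<Rightarrow> real" where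
  "sum_mod3 c M f = (\<Sum>n::nat | 0 < n \<and> int n \<le> M \<and> [int n = c] (mod 3). f n)"

text \<open>The functions \<open>u\<close> and \<open>v\<close> are only meant for \<open>n > 0\<close>.\<close>

definition u :: "nat \<Rightarrow> real" where
  "u n = 1 / 2 + of_bool (2 dvd n) * ((-1) ^ (n div 2) / 2 ^ n)
       - 3 / 2 * of_bool (3 dvd n) * (1 / 2 powr (2 * real n / 3))"

definition v :: "nat \<Rightarrow> real" where
  "v n = 1 / 2 + 1 / 4 * of_bool (2 dvd n) * ((-1) ^ (n div 2) / 2 ^ n)
       + 1 / 4 * of_bool (2 dvd (n - 1)) * ((-1) ^ ((n - 1) div 2) / 2 ^ n)
       - 3 / 4 * of_bool (3 dvd n) * (1 / 2 powr (2 * real n / 3))"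

text \<open>Used with \<open>e = (t + 2) / 3 - 1\<close> and \<open>e = (t + 1) / 3 - 1\<close>, where the indicator in front makes \<open>e\<close>
  a nonnegative integer. The power is a natural-number power because \<open>0 powr 0 = 0\<close>.\<close>

definition half_integral :: "int \<Rightarrow> real" where
  "half_integral e = integral {1 / 2..1} (\<lambda>x::real. (1 - x) ^ nat e / x)"

end

theory Submission
  imports Defs "HOL-Real_Asymp.Real_Asymp"
begin

text \<open>
  Substituting \<open>y = exp (- 2 x)\<close> turns the integrals \<open>I\<close> into integrals of \<open>y\<^sup>j / (1 + y)\<^sup>c\<close> over
  \<open>[0, 1]\<close>, and the two binomial sums in \<open>\<beta>\<close> become halves of the integrals \<open>G\<^sub>N\<close> over \<open>[0, 1]\<close> of the
  coefficients of \<open>s\<^sup>N\<close> in \<open>1 / (1 + y - s\<^sup>2 - y s\<^sup>3)\<close>, with \<open>N = 2 b\<close> and \<open>N = 2 a + 3\<close> respectively.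
  Since \<open>(1 - s\<^sup>3) / (1 + y - s\<^sup>2 - y s\<^sup>3)\<close> is the \<open>y\<close>-derivative of the logarithm of the denominator,
  \<open>G\<^sub>N - G\<^bsub>N-3\<^esub>\<close> is the coefficient of \<open>s\<^sup>N\<close> in
  \<open>ln ((2 - s\<^sup>2 - s\<^sup>3) / (1 - s\<^sup>2)) = ln 2 + ln (1 + s + s\<^sup>2 / 2) - ln (1 + s)\<close>, that is,
  \<open>((-1)\<^sup>N - 2 Re \<alpha>\<^sup>N) / N\<close> with \<open>\<alpha> = (-1 + \<i>) / 2\<close>. Summing these steps gives the two progressions modulo 3.
  When \<open>3\<close> divides the index, the terms with \<open>2\<close> to the power \<open>- 2 n / 3\<close> in \<open>u\<close> and \<open>v\<close> telescope against
  the integrals of \<open>(1 - x)\<^sup>e / x\<close>, whose differences in \<open>e\<close> are elementary.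
\<close>

section \<open>Reduction of \<open>I_integral\<close> to rational integrals over the unit
  interval\<close>

text \<open>With \<open>y = exp (- 2 x)\<close>, \<open>dx\<close> becomes
  \<open>- dy / (2 y)\<close>, so the exponent \<open>2 j + 2\<close> leaves exactly
  \<open>y ^ j\<close>. The substitution is made on bounded intervals; the integrand is nonnegative,
  so convergence of the truncated integrals gives the improper one.\<close>

lemma I_integral_substitution:
  "I_integral (2 * real j + 2) (real n)
     = 1 / 2 * integral {0..1} (\<lambda>y. y ^ j / (1 + y) ^ n)"
proof -
  define f where "f = (\<lambda>y::real. y ^ j / (1 + y) ^ n)"
  define h where "h = (\<lambda>x::real. exp (- (2 * real j + 2) * x) / (1 + exp (- 2 * x)) powr real n)"
  have cont: "continuous_on {0..1} f"
    unfolding f_def by (intro continuous_intros) auto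
  have h_eq: "h x = - 1 / 2 * (- 2 * exp (- 2 * x) * f (exp (- 2 * x)))" for x
  proof -
    have "exp (- (2 * real j + 2) * x) = exp (- 2 * x) * exp (- 2 * x) ^ j"
      by (simp add: exp_of_nat_mult [symmetric] exp_add [symmetric] algebra_simps)
    then show ?thesis
      by (simp add: h_def f_def powr_realpow add_pos_pos)
  qed
  have int_h: "(h has_integral 1 / 2 * integral {exp (- 2 * y)..1} f) {0..y}" if "y \<ge> 0" for y
  proof -
    have sub: "((\<lambda>x. (- 2 * exp (- 2 * x)) *\<^sub>R f (exp (- 2 * x))) has_integral
        (integral {exp (- 2 * 0)..exp (- 2 * y)} f - integral {exp (- 2 * y)..exp (- 2 * 0)} f)) {0..y}"
      by (rule has_integral_substitution_general[where s = "{}" and c = 0 and d = 1])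
        (use that cont in \<open>auto intro!: derivative_eq_intros continuous_intros\<close>)
    \<comment> \<open>The substitution rule allows either orientation and returns a difference of
      two integrals. Here \<open>exp (- 2 * y)\<close> is at most 1, so the second one is over an
      empty interval or a point.\<close>
    have "integral {1..exp (- 2 * y)} f = 0"
    proof (cases "y = 0")
      case False
      with that have "exp (- 2 * y) < 1" by simp
      then show ?thesis by simp
    qed simp
    with has_integral_mult_right[OF sub, of "- 1 / 2"] show ?thesis
      unfolding h_eq by (simp add: h_eq[abs_def])
  qed
  have "((\<lambda>s. integral {s..1} f) \<longlongrightarrow> integral {0..1} f) (at 0 within {0..1})"
    using indefinite_integral_continuous_1'[OF integrable_continuous_interval[OF cont]]
    by (simp add: continuous_on_def)
  moreover have "filterlim (\<lambda>y::real. exp (- 2 * y)) (at 0 within {0..1}) at_top"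
    unfolding filterlim_at
  proof
    show "\<forall>\<^sub>F y::real in at_top. exp (- 2 * y) \<in> {0..1} \<and> exp (- 2 * y) \<noteq> 0"
      using eventually_ge_at_top[of 0] by eventually_elim auto
    show "((\<lambda>y::real. exp (- 2 * y)) \<longlongrightarrow> 0) at_top" by real_asymp
  qed
  ultimately have lim: "((\<lambda>y. integral {exp (- 2 * y)..1} f) \<longlongrightarrow> integral {0..1} f) at_top"
    by (rule filterlim_compose)
  have "(h has_integral 1 / 2 * integral {0..1} f) {0..}"
  proof (rule has_integral_to_inf)
    show "h integrable_on {0..y}" for y
      using int_h[of y] by (cases "y \<ge> 0") auto
    show "((\<lambda>y. integral {0..y} h) \<longlongrightarrow> 1 / 2 * integral {0..1} f) at_top"
    proof (rule Lim_transform_eventually)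
      show "((\<lambda>y. 1 / 2 * integral {exp (- 2 * y)..1} f) \<longlongrightarrow> 1 / 2 * integral {0..1} f) at_top"
        by (intro tendsto_intros lim)
      show "\<forall>\<^sub>F y in at_top. 1 / 2 * integral {exp (- 2 * y)..1} f = integral {0..y} h"
        using eventually_ge_at_top[of 0]
        by eventually_elim (use int_h in \<open>metis integral_unique\<close>)
    qed
    show "h y \<ge> 0" for y unfolding h_def by simp
  qed
  then show ?thesis
    unfolding I_integral_def h_def f_def by (metis (no_types) integral_unique)
qed

section \<open>The kernel, its derivative in \<open>y\<close>, and its boundary values\<close>

text \<open>Shaped to the recurrence of \<open>kern\<close>, in which the term of index
  \<open>n + 3\<close> depends on those of index \<open>n + 1\<close> and \<open>n\<close>
  only.\<close>

lemma induct_nat_0123 [case_names 0 1 2 3]: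
  fixes P :: "nat \<Rightarrow> bool"
  assumes "P 0" "P (Suc 0)" "P (Suc (Suc 0))"
    and "\<And>n. P (Suc n) \<Longrightarrow> P n \<Longrightarrow> P (Suc (Suc (Suc n)))"
  shows "P n"
proof (induction n rule: less_induct)
  case (less n)
  consider "n = 0" | "n = Suc 0" | "n = Suc (Suc 0)" | m where "n = Suc (Suc (Suc m))"
    by (metis not0_implies_Suc)
  then show ?case
    by cases (use assms less in auto)
qed

text \<open>The coefficient of \<open>s\<^sup>n\<close> in \<open>1 / (1 + y - s\<^sup>2 - y s\<^sup>3)\<close>.\<close>
fun kern :: "nat \<Rightarrow> real \<Rightarrow> real" where
  "kern 0 y = 1 / (1 + y)"
| "kern (Suc 0) y = 0"
| "kern (Suc (Suc 0)) y = 1 / (1 + y) ^ 2"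
| "kern (Suc (Suc (Suc n))) y = (kern (Suc n) y + y * kern n y) / (1 + y)"

text \<open>The recurrence of \<open>kern\<close> differentiated by the quotient rule, with the
  quotient itself written as \<open>kern (n + 3) y\<close> so that only one division by
  \<open>1 + y\<close> remains.\<close>

fun kern_deriv :: "nat \<Rightarrow> real \<Rightarrow> real" where
  "kern_deriv 0 y = - 1 / (1 + y) ^ 2"
| "kern_deriv (Suc 0) y = 0"
| "kern_deriv (Suc (Suc 0)) y = - 2 / (1 + y) ^ 3"
| "kern_deriv (Suc (Suc (Suc n))) y =
     (kern_deriv (Suc n) y + kern n y + y * kern_deriv n y - kern (Suc (Suc (Suc n))) y) / (1 + y)"

lemma has_real_derivative_kern:
  assumes "y > - 1"
  shows "(kern n has_real_derivative kern_deriv n y) (at y)"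
proof (induction n rule: induct_nat_0123)
  case 0
  have "((\<lambda>y. 1 / (1 + y)) has_real_derivative kern_deriv 0 y) (at y)"
    using assms by (auto intro!: derivative_eq_intros simp: power2_eq_square)
  then show ?case by simp
next
  case 1
  then show ?case by simp
next
  case 2
  have "((\<lambda>y. 1 / (1 + y) ^ 2) has_real_derivative kern_deriv (Suc (Suc 0)) y) (at y)"
    using assms
    by (auto intro!: derivative_eq_intros simp: power2_eq_square power3_eq_cube divide_simps)
  then show ?case by simp
next
  case (3 n)
  have "((\<lambda>y. (kern (Suc n) y + y * kern n y) / (1 + y)) has_real_derivative
      kern_deriv (Suc (Suc (Suc n))) y) (at y)"
    using assms
    by (auto intro!: derivative_eq_intros 3 simp: divide_simps)
  then show ?case by simp
qed

lemma continuous_on_kern: "continuous_on {0..1} (kern n)"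
  by (rule continuous_at_imp_continuous_on)
    (auto intro!: DERIV_isCont[OF has_real_derivative_kern])

text \<open>The right-hand side is the derivative of \<open>- (2 kern (n + 1) y + 3 y kern n y)\<close>, which is \<open>n + 3\<close>
  times the coefficient of \<open>s\<close> to the power \<open>n + 3\<close> in \<open>ln (1 + y - s\<^sup>2 - y s\<^sup>3)\<close>.\<close>
lemma kern_difference:
  assumes "y > - 1"
  shows "real (n + 3) * (kern (n + 3) y - kern n y)
       = - 2 * kern_deriv (n + 1) y - 3 * kern n y - 3 * y * kern_deriv n y"
proof -
  \<comment> \<open>Trading division for a factor \<open>i\<close> with
    \<open>(1 + y) * i = 1\<close> turns all recurrences into polynomial identities.\<close>
  define i where "i = inverse (1 + y)"
  have i: "(1 + y) * i = 1" and y: "1 + y \<noteq> 0"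
    using assms by (simp_all add: i_def)
  have base: "kern 0 y = i" "kern (Suc 0) y = 0" "kern (Suc (Suc 0)) y = i * i"
    "kern_deriv 0 y = - (i * i)" "kern_deriv (Suc 0) y = 0" "kern_deriv (Suc (Suc 0)) y = - 2 * (i * i * i)"
    by (simp_all add: i_def divide_inverse power2_eq_square power3_eq_cube)
  have step: "kern (Suc (Suc (Suc m))) y = (kern (Suc m) y + y * kern m y) * i"
    "kern_deriv (Suc (Suc (Suc m))) y =
      (kern_deriv (Suc m) y + kern m y + y * kern_deriv m y - kern (Suc (Suc (Suc m))) y) * i" for m
    by (simp_all add: i_def divide_inverse)
  note [simp del] = kern.simps kern_deriv.simps
  show ?thesis
  proof (induction n rule: induct_nat_0123)
    case 0
    show ?case
      by (simp add: base step numeral_eq_Suc)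
  next
    case 1
    show ?case
      by (simp add: base step numeral_eq_Suc)
  next
    case 2
    show ?case
      by (simp add: base step numeral_eq_Suc) (simp add: algebra_simps)
  next
    case (3 n)
    define a where "a = kern n y"
    define b where "b = kern (n + 1) y"
    define d where "d = kern (n + 3) y"
    define e where "e = kern (n + 4) y"
    define f where "f = kern (n + 6) y"
    define a' where "a' = kern_deriv n y"
    define b' where "b' = kern_deriv (n + 1) y"
    define c' where "c' = kern_deriv (n + 2) y"
    define d' where "d' = kern_deriv (n + 3) y"
    define e' where "e' = kern_deriv (n + 4) y"
    have "d = (b + y * a) * i" "f = (e + y * d) * i"
      "d' = (b' + a + y * a' - d) * i" "e' = (c' + b + y * b' - e) * i"
      using step(1)[of n] step(1)[of "n + 3"] step(2)[of n] step(2)[of "n + 1"]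
      by (simp_all add: a_def b_def d_def e_def f_def a'_def b'_def c'_def d'_def e'_def numeral_eq_Suc)
    then have d: "(1 + y) * d = b + y * a" and f: "(1 + y) * f = e + y * d"
      and d': "(1 + y) * d' = b' + a + y * a' - d" and e': "(1 + y) * e' = c' + b + y * b' - e"
      using i by algebra+
    have IH1: "real (n + 4) * (e - b) = - 2 * c' - 3 * b - 3 * y * b'"
      using 3(1) by (simp add: e_def b_def b'_def c'_def numeral_eq_Suc)
    have IH2: "real (n + 3) * (d - a) = - 2 * b' - 3 * a - 3 * y * a'"
      using 3(2) by (simp add: d_def a_def a'_def b'_def numeral_eq_Suc)
    have "(1 + y) * (real (n + 6) * (f - d))
        = real (n + 6) * ((1 + y) * f) - real (n + 6) * ((1 + y) * d)"
      by (simp add: algebra_simps)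
    \<comment> \<open>The weight \<open>n + 6\<close> is split as \<open>(n + 4) + 2\<close> on
      \<open>e - b\<close> and as \<open>(n + 3) + 3\<close> on \<open>d - a\<close>, so that both
      induction hypotheses apply.\<close>
    also have "\<dots> = real (n + 4) * (e - b) + 2 * (e - b) + y * (real (n + 3) * (d - a)) + 3 * y * (d - a)"
      unfolding d f by (simp add: algebra_simps)
    also have "\<dots> = - 2 * ((1 + y) * e') - 3 * ((1 + y) * d) - 3 * y * ((1 + y) * d')"
      unfolding IH1 IH2 d d' e' by (simp add: algebra_simps)
    also have "\<dots> = (1 + y) * (- 2 * e' - 3 * d - 3 * y * d')"
      by (simp add: algebra_simps)
    finally have "(1 + y) * (real (n + 6) * (f - d)) = (1 + y) * (- 2 * e' - 3 * d - 3 * y * d')" .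
    then have "real (n + 6) * (f - d) = - 2 * e' - 3 * d - 3 * y * d'"
      using y by simp
    then show ?case
      by (simp add: f_def d_def e'_def d'_def numeral_eq_Suc)
  qed
qed

text \<open>The reciprocal of a root of \<open>1 + s + s\<^sup>2 / 2\<close>, the nontrivial factor of the generating function
  \<open>2 - s\<^sup>2 - s\<^sup>3 = 2 (1 - s) (1 + s + s\<^sup>2 / 2)\<close> at \<open>y = 1\<close>.\<close>
definition half_root :: complex where
  "half_root = Complex (- 1 / 2) (1 / 2)"

text \<open>Both sides satisfy \<open>2 x (n + 3) = x (n + 1) + x n\<close>: the right-hand side is
  the power sum of 1, \<open>half_root\<close> and its conjugate, which are the roots of
  \<open>2 z ^ 3 = z + 1\<close>. The left-hand side is the boundary term at \<open>y = 1\<close>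
  arising from \<open>kern_difference\<close>.\<close>

lemma kern_at_1: "2 * kern (n + 1) 1 + 3 * kern n 1 = 1 + 2 * Re (half_root ^ (n + 3))"
proof (induction n rule: induct_nat_0123)
  case 0
  show ?case
    by (simp add: half_root_def numeral_eq_Suc)
next
  case 1
  show ?case
    by (simp add: half_root_def numeral_eq_Suc)
next
  case 2
  show ?case
    by (simp add: half_root_def numeral_eq_Suc)
next
  case (3 n)
  have "half_root ^ 3 = (half_root + 1) / 2"
    by (simp add: half_root_def power3_eq_cube complex_eq_iff)
  then have "half_root ^ (n + 3 + 3) = half_root ^ (n + 3) * ((half_root + 1) / 2)"
    by (simp only: power_add)
  then have "half_root ^ (n + 6) = half_root ^ (n + 3) * ((half_root + 1) / 2)"
    by (simp add: numeral_eq_Suc)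
  also have "\<dots> = (half_root ^ (n + 4) + half_root ^ (n + 3)) / 2"
    by (simp add: power_add power3_eq_cube power4_eq_xxxx algebra_simps)
  finally have "2 * Re (half_root ^ (n + 6)) = Re (half_root ^ (n + 4)) + Re (half_root ^ (n + 3))"
    by (simp only: Re_divide_numeral plus_complex.sel) simp
  moreover have "kern (n + 4) 1 = (kern (n + 2) 1 + kern (n + 1) 1) / 2"
    "kern (n + 3) 1 = (kern (n + 1) 1 + kern n 1) / 2"
    by (simp_all add: numeral_eq_Suc)
  moreover have "2 * kern (n + 2) 1 + 3 * kern (n + 1) 1 = 1 + 2 * Re (half_root ^ (n + 4))"
    "2 * kern (n + 1) 1 + 3 * kern n 1 = 1 + 2 * Re (half_root ^ (n + 3))"
    using 3 by (simp_all add: numeral_eq_Suc del: power_Suc)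
  ultimately have "2 * kern (n + 4) 1 + 3 * kern (n + 3) 1 = 1 + 2 * Re (half_root ^ (n + 6))"
    by argo
  then show ?case
    by (simp add: numeral_eq_Suc del: power_Suc kern.simps)
qed

text \<open>At \<open>y = 0\<close> the generating function is
  \<open>1 / (1 - s ^ 2)\<close>.\<close>

lemma kern_at_0: "kern n 0 = of_bool (even n)"
  by (induction n rule: induct_nat_0123) auto

section \<open>Three-step recurrence of the kernel integrals\<close>

definition kern_integral :: "nat \<Rightarrow> real" where
  "kern_integral n = integral {0..1} (kern n)"

lemma kern_integral_step:
  "kern_integral (n + 3) = kern_integral n + ((- 1) ^ (n + 3) - 2 * Re (half_root ^ (n + 3))) / real (n + 3)"
proof -
  \<comment> \<open>The primitive supplied by \<open>kern_difference\<close>; its end values come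
    from \<open>kern_at_1\<close> and \<open>kern_at_0\<close>.\<close>
  define L where "L = (\<lambda>y. - (2 * kern (n + 1) y + 3 * y * kern n y) / real (n + 3))"
  have "((\<lambda>y. kern (n + 3) y - kern n y) has_integral (L 1 - L 0)) {0..1}"
  proof (rule fundamental_theorem_of_calculus)
    fix y :: real assume y: "y \<in> {0..1}"
    have *: "- (2 * kern_deriv (n + 1) y + (3 * kern n y + 3 * y * kern_deriv n y)) / real (n + 3) = kern (n + 3) y - kern n y"
      using kern_difference[of y n] y by (simp add: field_simps)
    have "(L has_real_derivative - (2 * kern_deriv (n + 1) y + (3 * kern n y + 3 * y * kern_deriv n y)) / real (n + 3)) (at y)"
      unfolding L_def using y
      by (auto intro!: derivative_eq_intros has_real_derivative_kern)
    then show "(L has_vector_derivative kern (n + 3) y - kern n y) (at y within {0..1})"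
      unfolding * has_real_derivative_iff_has_vector_derivative[symmetric]
      by (rule has_field_derivative_at_within)
  qed simp
  moreover have "((\<lambda>y. kern (n + 3) y - kern n y) has_integral (kern_integral (n + 3) - kern_integral n)) {0..1}"
    unfolding kern_integral_def
    by (intro has_integral_diff integrable_integral integrable_continuous_interval continuous_on_kern)
  ultimately have "kern_integral (n + 3) - kern_integral n = L 1 - L 0"
    by (rule has_integral_unique[symmetric])
  also have "L 1 - L 0 = (2 * of_bool (odd n) - (1 + 2 * Re (half_root ^ (n + 3)))) / real (n + 3)"
    unfolding L_def using kern_at_1[of n] kern_at_0[of "n + 1"]
    by (simp add: diff_divide_distrib add_divide_distrib)
  \<comment> \<open>The contribution of the lower limit and the constant 1 from the upper limit
    merge into a single sign.\<close>
  moreover have "2 * of_bool (odd n) - 1 = ((- 1) ^ (n + 3) :: real)"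
    by auto
  ultimately show ?thesis
    by (simp add: algebra_simps)
qed

section \<open>Binomial expansion of the kernel\<close>

text \<open>Expanding \<open>1 / ((1 + y) - s ^ 2 * (1 + y * s))\<close> geometrically gives the
  terms \<open>s ^ (2 q) * (1 + y * s) ^ q / (1 + y) ^ (q + 1)\<close>. This is the contribution of
  \<open>(y * s) ^ j\<close> to the coefficient of \<open>s ^ n\<close>, where
  \<open>n = 2 q + j\<close>.\<close>

definition kern_term :: "nat \<Rightarrow> nat \<Rightarrow> real \<Rightarrow> real" where
  "kern_term n j y = of_bool (j \<le> n \<and> even (n + j)) *
     (real ((n - j) div 2 choose j) * (y ^ j / (1 + y) ^ ((n - j) div 2 + 1)))"

text \<open>Pascal's rule for \<open>Suc q choose Suc j\<close>: the recurrence of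
  \<open>kern\<close> holds term by term.\<close>

lemma kern_term_Suc:
  assumes "y > - 1"
  shows "(1 + y) * kern_term (n + 3) (Suc j) y = kern_term (n + 1) (Suc j) y + y * kern_term n j y"
proof (cases "even (n + j)")
  case True
  show ?thesis
  proof (cases "j \<le> n")
    case le: True
    with True obtain q where n: "n = j + 2 * q"
      by (metis dvd_def even_add even_diff_nat le_add_diff_inverse)
    have y: "1 + y \<noteq> 0" using assms by simp
    have "kern_term (n + 3) (Suc j) y = real (Suc q choose Suc j) * (y ^ Suc j / (1 + y) ^ (q + 2))"
      "kern_term (n + 1) (Suc j) y = real (q choose Suc j) * (y ^ Suc j / (1 + y) ^ (q + 1))"
      "kern_term n j y = real (q choose j) * (y ^ j / (1 + y) ^ (q + 1))"
      by (auto simp: kern_term_def n)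
    moreover have "(1 + y) * (real (Suc q choose Suc j) * (y ^ Suc j / (1 + y) ^ (q + 2)))
        = real (Suc q choose Suc j) * (y ^ Suc j / (1 + y) ^ (q + 1))"
      using y by simp
    ultimately show ?thesis
      by (simp add: ring_distribs add_divide_distrib)
  next
    case False
    \<comment> \<open>For \<open>j = n + 2\<close> the indicator on the left still holds, but the
      term vanishes because the binomial coefficient is \<open>0 choose (n + 3)\<close>.\<close>
    then have "j = n + 2 \<or> \<not> Suc j \<le> n + 3" using True by presburger
    then show ?thesis using False by (auto simp: kern_term_def)
  qed
qed (simp add: kern_term_def)

lemma kern_eq_sum:
  assumes "y > - 1"
  shows "kern n y = (\<Sum>j\<le>n. kern_term n j y)"
proof (induction n rule: induct_nat_0123)
  case 0
  show ?case by (simp add: kern_term_def)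
next
  case 1
  show ?case by (simp add: kern_term_def)
next
  case 2
  show ?case by (simp add: kern_term_def atMost_Suc power2_eq_square)
next
  case (3 n)
  have y: "1 + y \<noteq> 0" using assms by simp
  \<comment> \<open>Vanishing beyond the index lets sums with different upper limits be compared;
    the term \<open>j = 0\<close> is split off because \<open>kern_term_Suc\<close> covers only
    successors.\<close>
  have zero: "kern_term m j y = 0" if "j > m" for m j
    using that by (simp add: kern_term_def)
  have "(1 + y) * (\<Sum>j\<le>n + 3. kern_term (n + 3) j y)
      = (1 + y) * kern_term (n + 3) 0 y + (\<Sum>j\<le>n + 2. (1 + y) * kern_term (n + 3) (Suc j) y)"
    using sum.atMost_Suc_shift[of "\<lambda>j. kern_term (n + 3) j y" "n + 2"]
    by (simp add: numeral_eq_Suc distrib_left sum_distrib_left)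
  also have "(1 + y) * kern_term (n + 3) 0 y = kern_term (n + 1) 0 y"
  proof (cases "odd n")
    case True
    then obtain q where "n = 2 * q + 1" by (elim oddE)
    then show ?thesis using y by (simp add: kern_term_def)
  qed (simp add: kern_term_def)
  also have "(\<Sum>j\<le>n + 2. (1 + y) * kern_term (n + 3) (Suc j) y)
      = (\<Sum>j\<le>n + 2. kern_term (n + 1) (Suc j) y) + y * (\<Sum>j\<le>n + 2. kern_term n j y)"
    by (simp only: kern_term_Suc[OF assms] sum.distrib sum_distrib_left)
  also have "kern_term (n + 1) 0 y + ((\<Sum>j\<le>n + 2. kern_term (n + 1) (Suc j) y) + y * (\<Sum>j\<le>n + 2. kern_term n j y))
      = (\<Sum>j\<le>n + 3. kern_term (n + 1) j y) + y * (\<Sum>j\<le>n + 2. kern_term n j y)"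
    using sum.atMost_Suc_shift[of "\<lambda>j. kern_term (n + 1) j y" "n + 2"]
    by (simp add: numeral_eq_Suc)
  also have "(\<Sum>j\<le>n + 3. kern_term (n + 1) j y) = (\<Sum>j\<le>n + 1. kern_term (n + 1) j y)"
    by (rule sum.mono_neutral_right) (auto simp: zero)
  also have "(\<Sum>j\<le>n + 2. kern_term n j y) = (\<Sum>j\<le>n. kern_term n j y)"
    by (rule sum.mono_neutral_right) (auto simp: zero)
  finally have "(1 + y) * (\<Sum>j\<le>n + 3. kern_term (n + 3) j y) = kern (n + 1) y + y * kern n y"
    using 3 by simp
  with y show ?case
    by (simp add: numeral_eq_Suc field_simps)
qed


lemma kern_even_sum:
  assumes "y > - 1"
  shows "kern (2 * b) y
       = (\<Sum>k\<le>b div 3. real (b - k choose (2 * k)) * (y ^ (2 * k) / (1 + y) ^ (b - k + 1)))"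
proof -
  have "kern (2 * b) y = (\<Sum>j\<in>(\<lambda>k. 2 * k) ` {..b div 3}. kern_term (2 * b) j y)"
    unfolding kern_eq_sum[OF assms]
  proof (rule sum.mono_neutral_right)
    show "\<forall>j\<in>{..2 * b} - (\<lambda>k. 2 * k) ` {..b div 3}. kern_term (2 * b) j y = 0"
    proof
      fix j assume j: "j \<in> {..2 * b} - (\<lambda>k. 2 * k) ` {..b div 3}"
      show "kern_term (2 * b) j y = 0"
      proof (cases "even j")
        case True
        then obtain k where k: "j = 2 * k" by (elim evenE)
        \<comment> \<open>Here \<open>k\<close> exceeds \<open>b div 3\<close>, so
          \<open>b - k < 2 * k\<close>: this is where the floor in the summation limit comes
          from.\<close>
        with j have "(2 * b - j) div 2 < j" by auto
        then show ?thesis by (simp add: kern_term_def binomial_eq_0)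
      qed (simp add: kern_term_def)
    qed
  qed auto
  also have "\<dots> = (\<Sum>k\<le>b div 3. kern_term (2 * b) (2 * k) y)"
    by (subst sum.reindex) (auto simp: inj_on_def)
  also have "\<dots> = (\<Sum>k\<le>b div 3. real (b - k choose (2 * k)) * (y ^ (2 * k) / (1 + y) ^ (b - k + 1)))"
  proof (rule sum.cong)
    fix k assume "k \<in> {..b div 3}"
    then have "2 * k \<le> 2 * b" "(2 * b - 2 * k) div 2 = b - k" by auto
    then show "kern_term (2 * b) (2 * k) y
        = real (b - k choose (2 * k)) * (y ^ (2 * k) / (1 + y) ^ (b - k + 1))"
      by (simp add: kern_term_def)
  qed simp
  finally show ?thesis .
qed

lemma kern_odd_sum:
  assumes "y > - 1"
  shows "kern (2 * a + 3) y
       = (\<Sum>k\<le>a div 3. real (a + 1 - k choose (2 * k + 1)) * (y ^ (2 * k + 1) / (1 + y) ^ (a + 2 - k)))"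
proof -
  have "kern (2 * a + 3) y = (\<Sum>j\<in>(\<lambda>k. 2 * k + 1) ` {..a div 3}. kern_term (2 * a + 3) j y)"
    unfolding kern_eq_sum[OF assms]
  proof (rule sum.mono_neutral_right)
    show "\<forall>j\<in>{..2 * a + 3} - (\<lambda>k. 2 * k + 1) ` {..a div 3}. kern_term (2 * a + 3) j y = 0"
    proof
      fix j assume j: "j \<in> {..2 * a + 3} - (\<lambda>k. 2 * k + 1) ` {..a div 3}"
      show "kern_term (2 * a + 3) j y = 0"
      proof (cases "odd j")
        case True
        then obtain k where k: "j = 2 * k + 1" by (elim oddE)
        \<comment> \<open>Again \<open>k > a div 3\<close> means
          \<open>a + 1 - k < 2 * k + 1\<close>.\<close>
        with j have "(2 * a + 3 - j) div 2 < j" by auto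
        then show ?thesis by (simp add: kern_term_def binomial_eq_0)
      qed (simp add: kern_term_def)
    qed
  qed auto
  also have "\<dots> = (\<Sum>k\<le>a div 3. kern_term (2 * a + 3) (2 * k + 1) y)"
    by (subst sum.reindex) (auto simp: inj_on_def)
  also have "\<dots> = (\<Sum>k\<le>a div 3. real (a + 1 - k choose (2 * k + 1)) * (y ^ (2 * k + 1) / (1 + y) ^ (a + 2 - k)))"
  proof (rule sum.cong)
    fix k assume "k \<in> {..a div 3}"
    then have "2 * k + 1 \<le> 2 * a + 3" "(2 * a + 3 - (2 * k + 1)) div 2 = a + 1 - k"
      "a + 1 - k + 1 = a + 2 - k" by auto
    then show "kern_term (2 * a + 3) (2 * k + 1) y
        = real (a + 1 - k choose (2 * k + 1)) * (y ^ (2 * k + 1) / (1 + y) ^ (a + 2 - k))"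
      unfolding kern_term_def by simp
  qed simp
  finally show ?thesis .
qed

section \<open>The binomial sums of \<open>I_integral\<close> as kernel integrals\<close>

lemma kern_integral_sum:
  assumes "\<And>y. y > - 1 \<Longrightarrow> kern n y = (\<Sum>k\<in>A. c k * (y ^ e k / (1 + y) ^ d k))"
  shows "(\<Sum>k\<in>A. c k * I_integral (2 * real (e k) + 2) (real (d k))) = kern_integral n / 2"
proof -
  have "kern_integral n = integral {0..1} (\<lambda>y. \<Sum>k\<in>A. c k * (y ^ e k / (1 + y) ^ d k))"
    unfolding kern_integral_def by (rule integral_cong) (simp add: assms)
  also have "\<dots> = (\<Sum>k\<in>A. c k * integral {0..1} (\<lambda>y. y ^ e k / (1 + y) ^ d k))"
  \<comment> \<open>For infinite \<open>A\<close> both sums are 0 by convention.\<close>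
  proof (cases "finite A")
    case True
    have "integral {0..1} (\<lambda>y. \<Sum>k\<in>A. c k * (y ^ e k / (1 + y) ^ d k))
        = (\<Sum>k\<in>A. integral {0..1} (\<lambda>y. c k * (y ^ e k / (1 + y) ^ d k)))"
      by (intro integral_sum True integrable_continuous_interval continuous_intros) auto
    then show ?thesis
      by (simp only: integral_mult_right)
  qed simp
  finally show ?thesis
    by (simp add: I_integral_substitution sum_divide_distrib)
qed

lemma I_integral_even_sum:
  "(\<Sum>k::nat | int k \<le> int b div 3. real (nat (int b - int k) choose (2 * k)) *
      I_integral (4 * real k + 2) (real b - real k + 1)) = kern_integral (2 * b) / 2"
proof -
  have "{k::nat. int k \<le> int b div 3} = {..b div 3}"
    by auto
  moreover have "(\<Sum>k\<le>b div 3. real (nat (int b - int k) choose (2 * k)) *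
        I_integral (4 * real k + 2) (real b - real k + 1))
      = (\<Sum>k\<le>b div 3. real (b - k choose (2 * k)) *
        I_integral (2 * real (2 * k) + 2) (real (b - k + 1)))"
  proof (rule sum.cong)
    fix k assume "k \<in> {..b div 3}"
    then have "k \<le> b" by auto
    then have "nat (int b - int k) = b - k" "real b - real k + 1 = real (b - k + 1)"
      "4 * real k + 2 = 2 * real (2 * k) + 2"
      by (auto simp: of_nat_diff)
    then show "real (nat (int b - int k) choose (2 * k)) * I_integral (4 * real k + 2) (real b - real k + 1)
        = real (b - k choose (2 * k)) * I_integral (2 * real (2 * k) + 2) (real (b - k + 1))"
      by (simp only:)
  qed simp
  ultimately show ?thesis
    using kern_integral_sum[OF kern_even_sum, of b] by (simp only:)
qed

lemma I_integral_odd_sum: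
  "(\<Sum>k::nat | int k \<le> int a div 3. real (nat (int a + 1 - int k) choose (2 * k + 1)) *
      I_integral (4 * real k + 4) (real a + 2 - real k)) = kern_integral (2 * a + 3) / 2"
proof -
  have "{k::nat. int k \<le> int a div 3} = {..a div 3}"
    by auto
  moreover have "(\<Sum>k\<le>a div 3. real (nat (int a + 1 - int k) choose (2 * k + 1)) *
        I_integral (4 * real k + 4) (real a + 2 - real k))
      = (\<Sum>k\<le>a div 3. real (a + 1 - k choose (2 * k + 1)) *
        I_integral (2 * real (2 * k + 1) + 2) (real (a + 2 - k)))"
  proof (rule sum.cong)
    fix k assume "k \<in> {..a div 3}"
    then have "k \<le> a" by auto
    then have "nat (int a + 1 - int k) = a + 1 - k" "real a + 2 - real k = real (a + 2 - k)"
      "4 * real k + 4 = 2 * real (2 * k + 1) + 2"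
      by (auto simp: of_nat_diff)
    then show "real (nat (int a + 1 - int k) choose (2 * k + 1)) * I_integral (4 * real k + 4) (real a + 2 - real k)
        = real (a + 1 - k choose (2 * k + 1)) * I_integral (2 * real (2 * k + 1) + 2) (real (a + 2 - k))"
      by (simp only:)
  qed simp
  ultimately show ?thesis
    using kern_integral_sum[OF kern_odd_sum, of a] by (simp only:)
qed

section \<open>The logarithmic integrals and the initial kernel integrals\<close>

lemma half_integral_0: "half_integral 0 = ln 2"
proof -
  have "((\<lambda>x::real. 1 / x) has_integral (ln 1 - ln (1 / 2))) {1 / 2..1}"
    by (rule fundamental_theorem_of_calculus)
      (auto intro!: derivative_eq_intros simp flip: has_real_derivative_iff_has_vector_derivative)
  then show ?thesis
    by (simp add: half_integral_def integral_unique ln_div)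
qed

text \<open>Writing one factor \<open>1 - x\<close> out gives
  \<open>(1 - x) ^ (n + 1) / x = (1 - x) ^ n / x - (1 - x) ^ n\<close>, and the last term has an
  elementary primitive.\<close>

lemma half_integral_Suc:
  "half_integral (int n + 1) = half_integral (int n) - (1 / 2) ^ Suc n / real (Suc n)"
proof -
  have "((\<lambda>x::real. (1 - x) ^ n) has_integral
      (- ((1 - 1) ^ Suc n) / real (Suc n) - (- ((1 - 1 / 2) ^ Suc n) / real (Suc n)))) {1 / 2..1}"
  proof (rule fundamental_theorem_of_calculus)
    fix x :: real
    have "((\<lambda>x. - ((1 - x) ^ Suc n) / real (Suc n)) has_real_derivative (1 - x) ^ n) (at x within {1 / 2..1})"
      by (rule derivative_eq_intros | simp del: power_Suc)+
    then show "((\<lambda>x. - ((1 - x) ^ Suc n) / real (Suc n)) has_vector_derivative (1 - x) ^ n) (at x within {1 / 2..1})"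
      by (simp only: has_real_derivative_iff_has_vector_derivative)
  qed simp
  then have "((\<lambda>x::real. (1 - x) ^ n) has_integral (1 / 2) ^ Suc n / real (Suc n)) {1 / 2..1}"
    by simp
  moreover have "((\<lambda>x::real. (1 - x) ^ n / x) has_integral half_integral (int n)) {1 / 2..1}"
    unfolding half_integral_def nat_int
    by (intro integrable_integral integrable_continuous_interval continuous_intros) auto
  ultimately have "((\<lambda>x::real. (1 - x) ^ n / x - (1 - x) ^ n) has_integral
      (half_integral (int n) - (1 / 2) ^ Suc n / real (Suc n))) {1 / 2..1}"
    by (rule has_integral_diff[rotated])
  moreover have "half_integral (int n + 1) = integral {1 / 2..1} (\<lambda>x. (1 - x) ^ n / x - (1 - x) ^ n)"
    unfolding half_integral_def
    by (rule integral_cong) (auto simp: nat_add_distrib field_simps)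
  ultimately show ?thesis
    by (metis (no_types) integral_unique)
qed

lemma kern_integral_0: "kern_integral 0 = ln 2"
proof -
  have "((\<lambda>x::real. 1 / (1 + x)) has_integral (ln (1 + 1) - ln (1 + 0))) {0..1}"
    by (rule fundamental_theorem_of_calculus)
      (auto intro!: derivative_eq_intros simp flip: has_real_derivative_iff_has_vector_derivative)
  moreover have "kern 0 = (\<lambda>y. 1 / (1 + y))" by (rule ext) simp
  ultimately show ?thesis
    by (simp add: kern_integral_def integral_unique)
qed

lemma kern_integral_1: "kern_integral 1 = 0"
proof -
  have "kern (Suc 0) = (\<lambda>_. 0)" by (rule ext) simp
  then show ?thesis by (simp add: kern_integral_def)
qed

lemma kern_integral_2: "kern_integral 2 = 1 / 2"
proof -
  have "((\<lambda>x::real. 1 / (1 + x)\<^sup>2) has_integral (- 1 / (1 + 1) - - 1 / (1 + 0))) {0..1}"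
    by (rule fundamental_theorem_of_calculus)
      (auto intro!: derivative_eq_intros simp: power2_eq_square simp flip: has_real_derivative_iff_has_vector_derivative)
  moreover have "kern 2 = (\<lambda>y. 1 / (1 + y)\<^sup>2)"
    by (rule ext) (simp add: numeral_2_eq_2)
  ultimately show ?thesis
    by (simp add: kern_integral_def integral_unique)
qed

section \<open>Real parts of powers of \<open>half_root\<close>\<close>

lemma half_root_power_4: "half_root ^ (4 * q) = of_real ((- 1) ^ q / 4 ^ q)"
proof -
  have "half_root ^ 4 = of_real (- 1 / 4)"
    by (simp add: half_root_def numeral_eq_Suc complex_eq_iff)
  then show ?thesis
    by (simp only: power_mult of_real_power [symmetric] power_divide)
qed

text \<open>The square of \<open>half_root\<close> is \<open>- \<i> / 2\<close>, so odd
  \<open>n\<close> gives a purely imaginary value. The result is the alternating term of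
  \<open>u\<close>.\<close>

lemma Re_half_root_even:
  "Re (half_root ^ (2 * n)) = of_bool (2 dvd n) * ((- 1) ^ (n div 2) / 2 ^ n)"
proof (cases "even n")
  case True
  then obtain q where "n = 2 * q" by (elim evenE)
  then show ?thesis
    using half_root_power_4[of q] by (simp add: power_mult)
next
  case False
  then obtain q where n: "n = 2 * q + 1" by (elim oddE)
  have "half_root ^ (2 * n) = half_root ^ (4 * q) * half_root ^ 2"
    by (simp add: n power_add [symmetric])
  then show ?thesis
    using False by (simp only: half_root_power_4) (simp add: half_root_def power2_eq_square)
qed

text \<open>Modulo fourth powers only the exponents 3 and 5 occur, with real parts
  \<open>1 / 4\<close> and \<open>1 / 8\<close>; this produces the two alternating terms of
  \<open>v\<close>. At \<open>n = 0\<close> the truncated \<open>n - 1\<close> would make both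
  indicators hold.\<close>

lemma Re_half_root_odd:
  assumes "n > 0"
  shows "Re (half_root ^ (2 * n + 3)) = 1 / 4 * of_bool (2 dvd n) * ((- 1) ^ (n div 2) / 2 ^ n)
       + 1 / 4 * of_bool (2 dvd (n - 1)) * ((- 1) ^ ((n - 1) div 2) / 2 ^ n)"
proof (cases "even n")
  case True
  then obtain q where n: "n = 2 * q" by (elim evenE)
  have "half_root ^ (2 * n + 3) = half_root ^ (4 * q) * half_root ^ 3"
    by (simp add: n power_add [symmetric])
  moreover have "odd (n - 1)" using assms True by simp
  ultimately show ?thesis
    by (simp only: half_root_power_4) (simp add: n half_root_def power3_eq_cube power_mult)
next
  case False
  then obtain q where n: "n = 2 * q + 1" by (elim oddE)
  have "2 * n + 3 = 4 * q + 5" by (simp add: n)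
  then have "half_root ^ (2 * n + 3) = half_root ^ (4 * q) * half_root ^ 5"
    by (simp only: power_add)
  moreover have "half_root ^ 5 = Complex (1 / 8) (- 1 / 8)"
    by (simp add: half_root_def numeral_eq_Suc complex_eq_iff)
  ultimately show ?thesis
    by (simp add: half_root_power_4) (simp add: n power_mult)
qed

section \<open>Sums over a residue class modulo 3\<close>

lemma sum_mod3_nonpos: "M \<le> 0 \<Longrightarrow> sum_mod3 c M f = 0"
  unfolding sum_mod3_def by (rule sum.neutral) auto

lemma sum_mod3_add3: "sum_mod3 (c + 3) M f = sum_mod3 c M f"
  by (simp add: sum_mod3_def cong_def)

lemma sum_mod3_last:
  assumes "n > 0" "[int n = c] (mod 3)"
  shows "sum_mod3 c (int n) f = sum_mod3 c (int n - 3) f + f n"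
proof -
  have "{k::nat. 0 < k \<and> int k \<le> int n \<and> [int k = c] (mod 3)}
      = insert n {k. 0 < k \<and> int k \<le> int n - 3 \<and> [int k = c] (mod 3)}"
  proof (intro equalityI subsetI)
    fix k assume k: "k \<in> {k::nat. 0 < k \<and> int k \<le> int n \<and> [int k = c] (mod 3)}"
    then have "int k mod 3 = int n mod 3" using assms(2) by (simp add: cong_def)
    moreover have "int k \<le> int n" using k by simp
    ultimately have "int k = int n \<or> int k \<le> int n - 3" by presburger
    then show "k \<in> insert n {k. 0 < k \<and> int k \<le> int n - 3 \<and> [int k = c] (mod 3)}"
      using k by auto
  qed (use assms in auto)
  moreover have "finite {k::nat. 0 < k \<and> int k \<le> int n - 3 \<and> [int k = c] (mod 3)}"
    by (rule finite_subset[of _ "{..n}"]) auto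
  ultimately show ?thesis
    by (simp add: sum_mod3_def)
qed

section \<open>Closed forms and their recurrences\<close>

text \<open>The closed form of \<open>kern_integral (2 * b)\<close>. Its \<open>v\<close>-sum stops
  one step before that of \<open>odd_value\<close>, the closed form of
  \<open>kern_integral (2 * a + 3)\<close>, so the two alternate along one progression.\<close>

definition even_value :: "int \<Rightarrow> real" where
  "even_value b = sum_mod3 b b (\<lambda>n. 1 / real n) - sum_mod3 b b (\<lambda>n. u n / real n)
     + of_bool (3 dvd b) * half_integral (2 * b div 3)
     - sum_mod3 b (b - 3) (\<lambda>n. v n / (real n + 3 / 2))"

definition odd_value :: "int \<Rightarrow> real" where
  "odd_value a = sum_mod3 a a (\<lambda>n. 1 / real n) - sum_mod3 a a (\<lambda>n. u n / real n)
     + of_bool (3 dvd a) * half_integral (2 * a div 3 + 1)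
     - sum_mod3 a a (\<lambda>n. v n / (real n + 3 / 2))"

text \<open>Only the \<open>v\<close>-term at \<open>n\<close> is added and the exponent in
  \<open>half_integral\<close> rises by one; the power of 2 in \<open>v\<close> cancels the change
  of that integral.\<close>

lemma odd_value_step:
  "odd_value (int n) = even_value (int n) + (- 1 - 2 * Re (half_root ^ (2 * n + 3))) / real (2 * n + 3)"
proof (cases "n = 0")
  case True
  \<comment> \<open>At 0 no \<open>v\<close>-term enters, and the integral alone accounts for the
    increment \<open>(- 1 - 1 / 2) / 3\<close>.\<close>
  have "half_integral 1 = half_integral 0 - 1 / 2"
    using half_integral_Suc[of 0] by simp
  then show ?thesis
    using True by (simp add: odd_value_def even_value_def sum_mod3_nonpos half_root_def power3_eq_cube)
next
  case False
  define w where "w = of_bool (3 dvd n) * (1 / 2 powr (2 * real n / 3))"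
  have H: "of_bool (3 dvd int n) * half_integral (2 * int n div 3 + 1)
      = of_bool (3 dvd int n) * half_integral (2 * int n div 3) - 3 / 4 * w / (real n + 3 / 2)"
  proof (cases "3 dvd n")
    case True
    then obtain j where j: "n = 3 * j" by (elim dvdE)
    have "2 * int n div 3 = int (2 * j)" by (simp add: j)
    moreover have "2 powr (2 * real n / 3) = 2 ^ (2 * j)"
      by (subst powr_realpow [symmetric]) (simp_all add: j)
    then have "w = (1 / 2) ^ (2 * j)" by (simp add: w_def j power_one_over)
    moreover have "3 / 4 * (1 / 2) ^ (2 * j) / (real n + 3 / 2) = (1 / 2) ^ Suc (2 * j) / real (Suc (2 * j))"
      by (simp add: j divide_simps)
    ultimately show ?thesis
      using half_integral_Suc[of "2 * j"] j by simp
  next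
    case False
    then have "\<not> 3 dvd int n" by presburger
    with False show ?thesis by (simp add: w_def)
  qed
  have "v n = 1 / 2 + Re (half_root ^ (2 * n + 3)) - 3 / 4 * w"
    using Re_half_root_odd[of n] False by (simp add: v_def w_def)
  moreover have "(2 * (1 / 2 + Re (half_root ^ (2 * n + 3)))) / (2 * (real n + 3 / 2))
      = (1 / 2 + Re (half_root ^ (2 * n + 3))) / (real n + 3 / 2)"
    by (rule mult_divide_mult_cancel_left) simp
  ultimately have V: "v n / (real n + 3 / 2) = (1 + 2 * Re (half_root ^ (2 * n + 3))) / real (2 * n + 3)
      - 3 / 4 * w / (real n + 3 / 2)"
    by (simp add: diff_divide_distrib)
  have "sum_mod3 (int n) (int n) (\<lambda>n. v n / (real n + 3 / 2))
      = sum_mod3 (int n) (int n - 3) (\<lambda>n. v n / (real n + 3 / 2)) + v n / (real n + 3 / 2)"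
    using False by (intro sum_mod3_last) auto
  then show ?thesis
    unfolding odd_value_def even_value_def H V
    by (simp add: diff_divide_distrib add_divide_distrib)
qed

text \<open>With \<open>m = n + 3\<close>, the new terms are \<open>1 / m - u m / m\<close>, the
  \<open>v\<close>-sum is unchanged, and the exponent rises by one again, which absorbs the power of
  2 in \<open>u\<close>.\<close>

lemma even_value_step:
  "even_value (int n + 3) = odd_value (int n) + (1 - 2 * Re (half_root ^ (2 * n + 6))) / real (2 * n + 6)"
proof -
  define m where "m = n + 3"
  define w where "w = of_bool (3 dvd m) * (1 / 2 powr (2 * real m / 3))"
  have m: "int n + 3 = int m" "m > 0" "int n = int m - 3" "2 * n + 6 = 2 * m"
    by (auto simp: m_def)
  have H: "of_bool (3 dvd int m) * half_integral (2 * int m div 3)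
      = of_bool (3 dvd int n) * half_integral (2 * int n div 3 + 1) - 3 / 2 * w / real m"
  proof (cases "3 dvd n")
    case True
    then obtain j where j: "n = 3 * j" by (elim dvdE)
    have "2 * int n div 3 + 1 = int (2 * j + 1)" "2 * int m div 3 = int (2 * j + 1) + 1"
      by (simp_all add: j m_def)
    moreover have "2 * real m / 3 = real (2 * j + 2)"
      by (simp add: j m_def)
    then have "2 powr (2 * real m / 3) = 2 ^ (2 * j + 2)"
      by (simp only:) (subst powr_realpow, simp_all)
    then have "w = (1 / 2) ^ Suc (2 * j + 1)" by (simp add: w_def j m_def power_one_over)
    moreover have "3 / 2 * (1 / 2) ^ Suc (2 * j + 1) / real m = (1 / 2) ^ Suc (2 * j + 1) / real (Suc (2 * j + 1))"
      by (simp add: j m_def divide_simps del: power_Suc)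
    moreover have "3 dvd int n" "3 dvd int m" by (simp_all add: j m_def)
    ultimately show ?thesis
      using half_integral_Suc[of "2 * j + 1"] by (simp add: add.commute del: power_Suc)
  next
    case False
    then have "\<not> 3 dvd int n" "\<not> 3 dvd m" "\<not> 3 dvd int m" unfolding m_def by presburger+
    then show ?thesis by (simp add: w_def)
  qed
  have u_eq: "u m = 1 / 2 + Re (half_root ^ (2 * m)) - 3 / 2 * w"
    by (simp add: u_def w_def Re_half_root_even)
  have U: "1 / real m - u m / real m = (1 - 2 * Re (half_root ^ (2 * m))) / real (2 * m)
      + 3 / 2 * w / real m"
    unfolding u_eq using m(2) by (simp add: field_simps)
  have shift: "sum_mod3 (int m) M f = sum_mod3 (int n) M f" for M f
    using sum_mod3_add3[of "int n" M f] unfolding m(1) .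
  have last: "sum_mod3 (int n) (int m) f = sum_mod3 (int n) (int n) f + f m" for f
    using sum_mod3_last[of m "int m" f] m(2) unfolding shift m(3)[symmetric] by simp
  show ?thesis
    unfolding m(1,4) odd_value_def even_value_def H m(3)[symmetric] shift last
    using U by linarith
qed

lemma kern_integral_odd_if_even:
  "kern_integral (2 * n) = even_value (int n) \<Longrightarrow> kern_integral (2 * n + 3) = odd_value (int n)"
  unfolding odd_value_step kern_integral_step by simp

lemma kern_integral_even: "kern_integral (2 * n) = even_value (int n)"
proof (induction n rule: induct_nat_0123)
  case 0
  show ?case
    by (simp add: even_value_def sum_mod3_nonpos kern_integral_0 half_integral_0)
next
  case 1
  have "sum_mod3 1 1 f = f 1" for f
    using sum_mod3_last[of 1 1 f] by (simp add: sum_mod3_nonpos)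
  then have "kern_integral (2 * 1) = even_value (int 1)"
    by (simp add: even_value_def sum_mod3_nonpos kern_integral_2 u_def)
  then show ?case by simp
next
  case 2
  have "sum_mod3 2 2 f = f 2" for f
    using sum_mod3_last[of 2 2 f] by (simp add: sum_mod3_nonpos)
  \<comment> \<open>Index 4 is reached from index 1, where the kernel vanishes identically.\<close>
  moreover have "kern_integral 4 = 3 / 8"
    using kern_integral_step[of 1] half_root_power_4[of 1] kern_integral_1 by simp
  ultimately have "kern_integral (2 * 2) = even_value (int 2)"
    by (simp add: even_value_def sum_mod3_nonpos u_def)
  then show ?case by (simp add: numeral_2_eq_2)
next
  case (3 n)
  have "kern_integral (2 * (n + 3)) = even_value (int (n + 3))"
    using even_value_step[of n] kern_integral_step[of "2 * n + 3"] kern_integral_odd_if_even[OF 3(2)]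
    by (simp add: add.commute)
  then show ?case by (simp only: numeral_3_eq_3 add_Suc_right add_0_right)
qed

lemmas kern_integral_odd = kern_integral_odd_if_even[OF kern_integral_even]

section \<open>Assembly of \<open>beta_star\<close>\<close>

lemma even_part:
  assumes "b \<ge> 0"
  shows "(\<Sum>k::nat | int k \<le> b div 3. real (nat (b - int k) choose (2 * k)) *
      I_integral (4 * real k + 2) (real_of_int b - real k + 1)) = even_value b / 2"
  using I_integral_even_sum[of "nat b"] kern_integral_even[of "nat b"] assms by simp

lemma odd_part:
  assumes "a \<ge> - 2"
  shows "(\<Sum>k::nat | int k \<le> a div 3. real (nat (a + 1 - int k) choose (2 * k + 1)) *
      I_integral (4 * real k + 4) (real_of_int a + 2 - real k)) = odd_value a / 2"
proof (cases "a \<ge> 0")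
  case True
  then show ?thesis
    using I_integral_odd_sum[of "nat a"] kern_integral_odd[of "nat a"] by simp
next
  case False
  then have "\<not> int k \<le> a div 3" for k :: nat by linarith
  \<comment> \<open>Only -1 and -2 remain, so the indicator kills the integral as well. These values
    occur for \<open>t\<close> equal to 1, 2 and 3.\<close>
  moreover have "\<not> 3 dvd a" using False assms by presburger
  ultimately show ?thesis
    using False by (simp add: odd_value_def sum_mod3_nonpos)
qed

lemma beta_star_even:
  assumes "t = 2 * b + 2" "b \<ge> 0"
  shows "beta_star t = (odd_value (b - 1) + even_value b) / 2"
proof -
  have t: "(t - 4) div 6 = (b - 1) div 3" "(t - 2) div 6 = b div 3"
    using assms by presburger+
  have "beta_star t
      = (\<Sum>k::nat | int k \<le> (b - 1) div 3. real (nat ((b - 1) + 1 - int k) choose (2 * k + 1)) *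
          I_integral (4 * real k + 4) (real_of_int (b - 1) + 2 - real k))
      + (\<Sum>k::nat | int k \<le> b div 3. real (nat (b - int k) choose (2 * k)) *
          I_integral (4 * real k + 2) (real_of_int b - real k + 1))"
    unfolding beta_star_def t
    by (simp add: assms diff_divide_distrib add_divide_distrib) (simp add: algebra_simps)
  then show ?thesis
    using odd_part[of "b - 1"] even_part[of b] assms(2) by simp
qed

lemma beta_star_odd:
  assumes "t = 2 * b + 1" "b \<ge> 0"
  shows "beta_star t = (even_value b + odd_value (b - 2)) / 2"
proof -
  have t: "(t - 5) div 6 = (b - 2) div 3" "(t - 1) div 6 = b div 3" "odd t"
    using assms by presburger+
  have "beta_star t
      = (\<Sum>k::nat | int k \<le> b div 3. real (nat (b - int k) choose (2 * k)) *
          I_integral (4 * real k + 2) (real_of_int b - real k + 1))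
      + (\<Sum>k::nat | int k \<le> (b - 2) div 3. real (nat ((b - 2) + 1 - int k) choose (2 * k + 1)) *
          I_integral (4 * real k + 4) (real_of_int (b - 2) + 2 - real k))"
    unfolding beta_star_def t
    by (simp add: assms diff_divide_distrib add_divide_distrib) (simp add: algebra_simps)
  then show ?thesis
    using odd_part[of "b - 2"] even_part[of b] assms(2) by simp
qed

theorem theorem5p1:
  fixes t :: int
  assumes "t \<ge> 1"
  shows "(even t \<longrightarrow> beta_star t = 1 / 2 * (
             sum_mod3 (t div 2 - 2) (t div 2 - 2) (\<lambda>n. 1 / real n)
           - sum_mod3 (t div 2 - 2) (t div 2 - 2) (\<lambda>n. u n / real n)
           + of_bool (6 dvd (t - 4)) * half_integral ((t + 2) div 3 - 1)
           - sum_mod3 (t div 2 - 2) (t div 2 - 2) (\<lambda>n. v n / (real n + 3 / 2))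
           + sum_mod3 (t div 2 - 1) (t div 2 - 1) (\<lambda>n. 1 / real n)
           - sum_mod3 (t div 2 - 1) (t div 2 - 1) (\<lambda>n. u n / real n)
           + of_bool (6 dvd (t - 2)) * half_integral ((t + 1) div 3 - 1)
           - sum_mod3 (t div 2 - 1) (t div 2 - 4) (\<lambda>n. v n / (real n + 3 / 2))))
       \<and> (odd t \<longrightarrow> beta_star t = 1 / 2 * (
             sum_mod3 ((t - 1) div 2) ((t - 1) div 2) (\<lambda>n. 1 / real n)
           - sum_mod3 ((t - 1) div 2) ((t - 1) div 2) (\<lambda>n. u n / real n)
           + of_bool (6 dvd (t - 1)) * half_integral ((t + 2) div 3 - 1)
           - sum_mod3 ((t - 1) div 2) ((t - 1) div 2 - 3) (\<lambda>n. v n / (real n + 3 / 2))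
           + sum_mod3 ((t - 5) div 2) ((t - 5) div 2) (\<lambda>n. 1 / real n)
           - sum_mod3 ((t - 5) div 2) ((t - 5) div 2) (\<lambda>n. u n / real n)
           + of_bool (6 dvd (t - 5)) * half_integral ((t + 1) div 3 - 1)
           - sum_mod3 ((t - 5) div 2) ((t - 5) div 2) (\<lambda>n. v n / (real n + 3 / 2))))"
proof (intro conjI impI)
  assume "even t"
  define b where "b = t div 2 - 1"
  have t: "t = 2 * b + 2" "b \<ge> 0" using \<open>even t\<close> assms unfolding b_def by presburger+
  \<comment> \<open>In terms of \<open>b\<close> the two progressions are those of
    \<open>odd_value (b - 1)\<close> and \<open>even_value b\<close>.\<close>
  have "t div 2 - 2 = b - 1" "t div 2 - 1 = b" "t div 2 - 4 = b - 3"
    "6 dvd (t - 4) \<longleftrightarrow> 3 dvd (b - 1)" "6 dvd (t - 2) \<longleftrightarrow> 3 dvd b"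
    "(t + 2) div 3 - 1 = 2 * (b - 1) div 3 + 1" "(t + 1) div 3 - 1 = 2 * b div 3"
    using t by presburger+
  then show "beta_star t = 1 / 2 * (
             sum_mod3 (t div 2 - 2) (t div 2 - 2) (\<lambda>n. 1 / real n)
           - sum_mod3 (t div 2 - 2) (t div 2 - 2) (\<lambda>n. u n / real n)
           + of_bool (6 dvd (t - 4)) * half_integral ((t + 2) div 3 - 1)
           - sum_mod3 (t div 2 - 2) (t div 2 - 2) (\<lambda>n. v n / (real n + 3 / 2))
           + sum_mod3 (t div 2 - 1) (t div 2 - 1) (\<lambda>n. 1 / real n)
           - sum_mod3 (t div 2 - 1) (t div 2 - 1) (\<lambda>n. u n / real n)
           + of_bool (6 dvd (t - 2)) * half_integral ((t + 1) div 3 - 1)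
           - sum_mod3 (t div 2 - 1) (t div 2 - 4) (\<lambda>n. v n / (real n + 3 / 2)))"
    unfolding beta_star_even[OF t] even_value_def odd_value_def by (simp only:) simp
next
  assume "odd t"
  define b where "b = (t - 1) div 2"
  have t: "t = 2 * b + 1" "b \<ge> 0" using \<open>odd t\<close> assms unfolding b_def by presburger+
  \<comment> \<open>Here they are those of \<open>even_value b\<close> and
    \<open>odd_value (b - 2)\<close>.\<close>
  have "(t - 1) div 2 = b" "(t - 5) div 2 = b - 2"
    "6 dvd (t - 1) \<longleftrightarrow> 3 dvd b" "6 dvd (t - 5) \<longleftrightarrow> 3 dvd (b - 2)"
    "(t + 2) div 3 - 1 = 2 * b div 3" "(t + 1) div 3 - 1 = 2 * (b - 2) div 3 + 1"
    using t by presburger+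
  then show "beta_star t = 1 / 2 * (
             sum_mod3 ((t - 1) div 2) ((t - 1) div 2) (\<lambda>n. 1 / real n)
           - sum_mod3 ((t - 1) div 2) ((t - 1) div 2) (\<lambda>n. u n / real n)
           + of_bool (6 dvd (t - 1)) * half_integral ((t + 2) div 3 - 1)
           - sum_mod3 ((t - 1) div 2) ((t - 1) div 2 - 3) (\<lambda>n. v n / (real n + 3 / 2))
           + sum_mod3 ((t - 5) div 2) ((t - 5) div 2) (\<lambda>n. 1 / real n)
           - sum_mod3 ((t - 5) div 2) ((t - 5) div 2) (\<lambda>n. u n / real n)
           + of_bool (6 dvd (t - 5)) * half_integral ((t + 1) div 3 - 1)
           - sum_mod3 ((t - 5) div 2) ((t - 5) div 2) (\<lambda>n. v n / (real n + 3 / 2)))"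
    unfolding beta_star_odd[OF t] even_value_def odd_value_def by (simp only:) simp
qed

end
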